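(* Let $S$ be a set of $n\ge 1$ keys and let $h_0,h_1:S\to[n]$ be independent uniformly random functions. Then the probability that there exists a function $f:S\to\{0,1\}$ such that the map $x\mapsto h_{f(x)}(x)$ is a bijection from $S$ to $[n]$ is at least $(e/2)^{-n}e^{-1}\sqrt{\pi}$.
   Context: $[n]=\{1,\dots,n\}$. The hash functions are assumed fully random (every value independent and uniform on $[n]$). *)

theory Defs
  imports "HOL-Probability.Probability"
begin

text \<open>
  A uniformly random function from \<open>S\<close> to \<open>[n]\<close>. Functions are taken
  extensional (\<open>undefined\<close> outside \<open>S\<close>), so that every function
  on \<open>S\<close> is counted exactly once; equivalently, all values on \<open>S\<close> are
  independent and uniform on \<open>[n]\<close>. Meaningful for finite \<open>S\<close> and \<open>n \<ge> 1\<close>.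
\<close>
definition random_fun :: "'k set \<Rightarrow> nat \<Rightarrow> ('k \<Rightarrow> nat) pmf" where
  "random_fun S n = pmf_of_set (S \<rightarrow>\<^sub>E {1..n})"

end

theory Submission
  imports Defs
begin

text \<open>
  Second moment method. Let \<open>X\<close> be the number of valid choices \<open>f\<close>. Each of the \<open>2\<^sup>n\<close> choices is
  valid with probability \<open>n! / n\<^sup>n\<close>. If two choices differ exactly on a set \<open>D\<close> of size \<open>d\<close>, then
  (after exchanging the two hash functions wherever the first choice selects \<open>h\<^sub>1\<close>) both are valid
  iff \<open>h\<^sub>0\<close> is bijective and \<open>h\<^sub>1\<close> maps \<open>D\<close> bijectively onto \<open>h\<^sub>0(D)\<close>, which has
  probability \<open>n! d! / n\<^bsup>n+d\<^esup>\<close>. Hence \<open>E X\<^sup>2 / (E X)\<^sup>2\<close> equals \<open>2\<^bsup>-n\<^esup>\<close> times the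
  partial sum \<open>\<Sum>m\<le>n. n\<^sup>m / m!\<close> of the series of \<open>e\<^sup>n\<close>, so that \<open>P(X > 0) \<ge> (2/e)\<^sup>n\<close>.
  The remaining factor \<open>sqrt pi / e\<close> is at most 1.
\<close>

text \<open>A choice is encoded by the set \<open>T\<close> of keys at which it takes the second
  function. Choices are then subsets of the key set, and two of them differ exactly on their
  symmetric difference.\<close>

definition mix :: "'k set \<Rightarrow> ('k \<Rightarrow> 'b) \<Rightarrow> ('k \<Rightarrow> 'b) \<Rightarrow> 'k \<Rightarrow> 'b" where
  "mix T g h = (\<lambda>x. if x \<in> T then h x else g x)"

lemma mix_PiE:
  assumes "g \<in> S \<rightarrow>\<^sub>E B" "h \<in> S \<rightarrow>\<^sub>E B"
  shows "mix T g h \<in> S \<rightarrow>\<^sub>E B"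
  using assms by (auto simp: mix_def PiE_iff extensional_def)

lemma mix_empty [simp]: "mix {} g h = g"
  by (simp add: mix_def)

text \<open>Exchanging \<open>g\<close> and \<open>h\<close> on \<open>T\<close> turns the choice
  \<open>T\<close> into taking the first function everywhere; the choice \<open>T'\<close> then
  departs from it exactly on \<open>sym_diff T T'\<close>.\<close>

lemma mix_mix: "mix T' g h = mix (sym_diff T T') (mix T g h) (mix T h g)"
  by (auto simp: mix_def fun_eq_iff)

section \<open>Counting bijections and pairs of valid choices\<close>

lemma card_bij_betw_funcset:
  assumes "finite A" "finite B" "card A = card B"
  shows "card {f \<in> A \<rightarrow>\<^sub>E B. bij_betw f A B} = fact (card A)"
proof -
  \<comment> \<open>An injection between finite sets of equal size is onto, so it suffices to count
    injections.\<close>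
  have "f ` A = B" if "f \<in> A \<rightarrow>\<^sub>E B" "inj_on f A" for f
    using that assms by (intro card_subset_eq) (auto simp: card_image)
  then have "{f \<in> A \<rightarrow>\<^sub>E B. bij_betw f A B} = {f \<in> A \<rightarrow>\<^sub>E B. inj_on f A}"
    by (auto simp: bij_betw_def)
  also have "card \<dots> = (\<Prod>i = 0..<card A. card A - i)"
    using card_inj_on_subset_funcset[OF assms(1,2) subset_refl] assms(3) by simp
  also have "\<dots> = fact (card A)"
    by (simp add: fact_prod_rev)
  finally show ?thesis .
qed

text \<open>The restrictions to \<open>D\<close> and \<open>S - D\<close> can be chosen
  independently: a bijection onto \<open>C\<close>, and an arbitrary function into
  \<open>B\<close>.\<close>

lemma card_bij_betw_subset_funcset:
  assumes "finite S" "finite B" "D \<subseteq> S" "C \<subseteq> B" "card D = card C"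
  shows "card {f \<in> S \<rightarrow>\<^sub>E B. bij_betw f D C} = fact (card D) * card B ^ (card S - card D)"
proof -
  let ?L = "{f \<in> S \<rightarrow>\<^sub>E B. bij_betw f D C}"
  let ?R = "{f \<in> D \<rightarrow>\<^sub>E C. bij_betw f D C} \<times> (S - D \<rightarrow>\<^sub>E B)"
  have "bij_betw (\<lambda>f. (restrict f D, restrict f (S - D))) ?L ?R"
  \<comment> \<open>The inverse glues \<open>g\<close> on \<open>D\<close> to \<open>h\<close>
    elsewhere. As \<open>h\<close> is \<open>undefined\<close> outside \<open>S - D\<close>, the
    glued function is \<open>undefined\<close> outside \<open>S\<close>.\<close>
  proof (rule bij_betwI[where g = "\<lambda>(g, h). mix D h g"])
    show "(\<lambda>f. (restrict f D, restrict f (S - D))) \<in> ?L \<rightarrow> ?R"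
      by (auto simp: restrict_PiE_iff bij_betw_def)
    show "(\<lambda>(g, h). mix D h g) \<in> ?R \<rightarrow> ?L"
    proof (rule funcsetI, clarify)
      fix g h assume g: "g \<in> D \<rightarrow>\<^sub>E C" "bij_betw g D C" and h: "h \<in> S - D \<rightarrow>\<^sub>E B"
      have "bij_betw (mix D h g) D C"
        using g(2) by (subst bij_betw_cong[where g = g]) (auto simp: mix_def)
      moreover have "mix D h g \<in> S \<rightarrow>\<^sub>E B"
        using g(1) h assms(3,4) by (auto simp: mix_def PiE_iff extensional_def)
      ultimately show "mix D h g \<in> S \<rightarrow>\<^sub>E B \<and> bij_betw (mix D h g) D C" by simp
    qed
    show "(case (restrict f D, restrict f (S - D)) of (g, h) \<Rightarrow> mix D h g) = f" if "f \<in> ?L" for f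
      using that by (auto simp: mix_def fun_eq_iff PiE_iff extensional_def)
    show "(restrict (case y of (g, h) \<Rightarrow> mix D h g) D,
           restrict (case y of (g, h) \<Rightarrow> mix D h g) (S - D)) = y" if "y \<in> ?R" for y
      using that by (auto simp: mix_def fun_eq_iff PiE_iff extensional_def)
  qed
  then have "card ?L = card ?R" by (rule bij_betw_same_card)
  also have "\<dots> = fact (card D) * card B ^ (card S - card D)"
    using assms finite_subset[OF assms(3,1)] finite_subset[OF assms(4,2)]
    by (simp add: card_cartesian_product card_bij_betw_funcset card_funcsetE card_Diff_subset)
  finally show ?thesis .
qed

text \<open>Off \<open>D\<close> the mixture agrees with \<open>g\<close>, which already maps
  \<open>S - D\<close> bijectively onto the complement of the image of \<open>D\<close>. Only the
  behaviour on \<open>D\<close> remains in question, and there the mixture is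
  \<open>h\<close>.\<close>

lemma bij_betw_mix_iff:
  assumes "bij_betw g S B" "D \<subseteq> S"
  shows "bij_betw (mix D g h) S B \<longleftrightarrow> bij_betw h D (g ` D)"
proof -
  have rest: "bij_betw (mix D g h) (S - D) (B - g ` D)"
  proof -
    have "bij_betw g (S - D) (B - g ` D)"
      using assms by (intro bij_betw_DiffI bij_betw_subset[OF assms(1)]) (auto simp: bij_betw_def)
    then show ?thesis
      by (subst bij_betw_cong[where g = g]) (auto simp: mix_def)
  qed
  have D: "bij_betw (mix D g h) D (g ` D) \<longleftrightarrow> bij_betw h D (g ` D)"
    by (rule bij_betw_cong) (simp add: mix_def)
  have S: "D \<union> (S - D) = S" and B: "g ` D \<union> (B - g ` D) = B"
    using assms by (auto simp: bij_betw_def)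
  show ?thesis
  proof
    assume "bij_betw (mix D g h) S B"
    then show "bij_betw h D (g ` D)"
      using bij_betw_partition[of "mix D g h" D "S - D" "g ` D" "B - g ` D"] rest D
      unfolding S B by auto
  next
    assume "bij_betw h D (g ` D)"
    then show "bij_betw (mix D g h) S B"
      using bij_betw_combine[of "mix D g h" D "g ` D" "S - D" "B - g ` D"] rest D
      unfolding S B by auto
  qed
qed

lemma card_bij_betw_mix_pair:
  assumes "finite S" "finite B" "card S = card B" "T \<subseteq> S" "T' \<subseteq> S"
  defines "\<Omega> \<equiv> (S \<rightarrow>\<^sub>E B) \<times> (S \<rightarrow>\<^sub>E B)" and "d \<equiv> card (sym_diff T T')"
  shows "card {(g, h) \<in> \<Omega>. bij_betw (mix T g h) S B \<and> bij_betw (mix T' g h) S B}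
    = fact (card S) * (fact d * card S ^ (card S - d))"
proof -
  define D where "D = sym_diff T T'"
  have D: "D \<subseteq> S" using assms by (auto simp: D_def)
  let ?L = "{(g, h) \<in> \<Omega>. bij_betw (mix T g h) S B \<and> bij_betw (mix T' g h) S B}"
  let ?R = "SIGMA g : {g \<in> S \<rightarrow>\<^sub>E B. bij_betw g S B}. {h \<in> S \<rightarrow>\<^sub>E B. bij_betw h D (g ` D)}"
  \<comment> \<open>Exchanging the functions on \<open>T\<close> is an involution, so
    \<open>?swap\<close> is its own inverse: \<open>mixD\<close> serves the map into
    \<open>?R\<close>, \<open>mixD'\<close> the map back.\<close>
  let ?swap = "\<lambda>(g, h). (mix T g h, mix T h g)"
  have swap2: "mix T (mix T g h) (mix T h g) = g" for g h :: "'a \<Rightarrow> 'b"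
    by (auto simp: mix_def fun_eq_iff)
  have mixD: "mix T' g h = mix D (mix T g h) (mix T h g)" for g h :: "'a \<Rightarrow> 'b"
    unfolding D_def by (rule mix_mix)
  have mixD': "mix T' (mix T g h) (mix T h g) = mix D g h" for g h :: "'a \<Rightarrow> 'b"
    unfolding mixD by (simp add: swap2)
  note bij_D = bij_betw_mix_iff[where S = S and B = B, OF _ D]
  have "bij_betw ?swap ?L ?R"
  proof (rule bij_betwI[where g = ?swap])
    show "?swap \<in> ?L \<rightarrow> ?R"
      by (auto simp: \<Omega>_def mix_PiE mixD bij_D del: PiE_I PiE_E)
    show "?swap \<in> ?R \<rightarrow> ?L"
      by (auto simp: \<Omega>_def mix_PiE mixD' swap2 bij_D del: PiE_I PiE_E)
  qed (auto simp: swap2)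
  then have "card ?L = card ?R" by (rule bij_betw_same_card)
  also have "\<dots> = (\<Sum>g \<in> {g \<in> S \<rightarrow>\<^sub>E B. bij_betw g S B}. card {h \<in> S \<rightarrow>\<^sub>E B. bij_betw h D (g ` D)})"
    using assms by (intro card_SigmaI) (auto intro!: finite_PiE)
  \<comment> \<open>The number of admissible \<open>h\<close> is the same for every
    \<open>g\<close>: injectivity makes the image of \<open>D\<close> have size
    \<open>d\<close>.\<close>
  also have "\<dots> = (\<Sum>g \<in> {g \<in> S \<rightarrow>\<^sub>E B. bij_betw g S B}. fact d * card S ^ (card S - d))"
  proof (rule sum.cong[OF refl])
    fix g assume "g \<in> {g \<in> S \<rightarrow>\<^sub>E B. bij_betw g S B}"
    then have g: "bij_betw g S B" by simp
    then have "g ` D \<subseteq> B" "card D = card (g ` D)"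
      using D by (auto simp: bij_betw_def card_image inj_on_subset)
    then show "card {h \<in> S \<rightarrow>\<^sub>E B. bij_betw h D (g ` D)} = fact d * card S ^ (card S - d)"
      using card_bij_betw_subset_funcset[OF assms(1,2) D, of "g ` D"] assms(3)
      by (simp add: d_def D_def)
  qed
  also have "\<dots> = fact (card S) * (fact d * card S ^ (card S - d))"
    using assms by (simp add: card_bij_betw_funcset)
  finally show ?thesis .
qed

section \<open>Sums over subsets and the second moment bound\<close>

lemma sum_Pow_card:
  fixes c :: "nat \<Rightarrow> 'b::comm_semiring_1"
  assumes "finite S"
  shows "(\<Sum>D\<in>Pow S. c (card D)) = (\<Sum>d\<le>card S. of_nat (card S choose d) * c d)"
proof -
  have "(\<Sum>D\<in>Pow S. c (card D)) = (\<Sum>d\<le>card S. \<Sum>D | D \<in> Pow S \<and> card D = d. c (card D))"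
    using assms by (intro sum.group[symmetric]) (auto intro: card_mono)
  also have "\<dots> = (\<Sum>d\<le>card S. of_nat (card S choose d) * c d)"
    using assms by (intro sum.cong refl) (simp add: n_subsets)
  finally show ?thesis .
qed

text \<open>\<open>sym_diff T\<close> is an involution on \<open>Pow S\<close>. Hence in the second
  moment the inner sum does not depend on the first choice.\<close>

lemma sum_Pow_sym_diff:
  assumes "T \<subseteq> S"
  shows "(\<Sum>T'\<in>Pow S. c (sym_diff T T')) = (\<Sum>D\<in>Pow S. c D)"
  using assms by (intro sum.reindex_bij_witness[of _ "sym_diff T" "sym_diff T"]) auto

lemma sum_power_div_fact_le_exp:
  fixes x :: real
  assumes "x \<ge> 0"
  shows "(\<Sum>m\<le>n. x ^ m / fact m) \<le> exp x"
proof -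
  have sm: "(\<lambda>m. x ^ m / fact m) sums exp x"
    using exp_converges[of x] by (simp add: field_simps)
  show ?thesis
    using assms sum_le_suminf[OF sums_summable[OF sm], of "{..n}"] sums_unique[OF sm] by simp
qed

text \<open>Cauchy-Schwarz for \<open>X\<close> against the indicator of its support: the counting
  form of P(X \<noteq> 0) * E X^2 \<ge> (E X)^2 under the uniform distribution.\<close>

lemma second_moment:
  fixes X :: "'a \<Rightarrow> real"
  assumes "finite \<Omega>"
  shows "(\<Sum>w\<in>\<Omega>. X w)\<^sup>2 \<le> card {w \<in> \<Omega>. X w \<noteq> 0} * (\<Sum>w\<in>\<Omega>. (X w)\<^sup>2)"
proof -
  have "(\<Sum>w\<in>\<Omega>. of_bool (X w \<noteq> 0) * X w)\<^sup>2
      \<le> (\<Sum>w\<in>\<Omega>. (of_bool (X w \<noteq> 0))\<^sup>2) * (\<Sum>w\<in>\<Omega>. (X w)\<^sup>2)"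
    by (rule Cauchy_Schwarz_ineq_sum)
  moreover have "(\<Sum>w\<in>\<Omega>. of_bool (X w \<noteq> 0) * X w) = (\<Sum>w\<in>\<Omega>. X w)"
    by (intro sum.cong) auto
  moreover have "(\<Sum>w\<in>\<Omega>. (of_bool (X w \<noteq> 0))\<^sup>2) = real (card {w \<in> \<Omega>. X w \<noteq> 0})"
    using assms by (simp add: sum.If_cases of_bool_def Int_def if_distrib[of "\<lambda>x. x\<^sup>2"] cong: if_cong)
  ultimately show ?thesis by simp
qed

text \<open>Counting form of the lower bound (2/e)^n; n^(2n) is the number of all pairs of
  functions.\<close>

lemma card_exists_bij_mix_ge:
  fixes S :: "'k set" and B :: "'b set"
  assumes fin: "finite S" "finite B" and card: "card S = n" "card B = n"
  shows "2 ^ n * real n ^ (2 * n) \<le> exp n *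
    card {(g, h) \<in> (S \<rightarrow>\<^sub>E B) \<times> (S \<rightarrow>\<^sub>E B). \<exists>T\<subseteq>S. bij_betw (mix T g h) S B}"
proof -
  define \<Omega> where "\<Omega> = (S \<rightarrow>\<^sub>E B) \<times> (S \<rightarrow>\<^sub>E B)"
  define I where "I T w = (of_bool (bij_betw (mix T (fst w) (snd w)) S B) :: real)" for T w
  define X where "X w = (\<Sum>T\<in>Pow S. I T w)" for w
  \<comment> \<open>For d \<le> n, \<open>c d\<close> counts the pairs of functions that make two
    given choices differing at exactly \<open>d\<close> keys both valid.\<close>
  define c where "c d = (fact n * (fact d * real n ^ (n - d)))" for d
  have \<Omega>: "finite \<Omega>" using fin by (auto simp: \<Omega>_def intro!: finite_PiE)
  have pair: "(\<Sum>w\<in>\<Omega>. I T w * I T' w) = c (card (sym_diff T T'))"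
    if "T \<in> Pow S" "T' \<in> Pow S" for T T'
  proof -
    have "(\<Sum>w\<in>\<Omega>. I T w * I T' w) = 
       (\<Sum>w\<in>\<Omega>. of_bool (case w of (g, h) \<Rightarrow> bij_betw (mix T g h) S B \<and> bij_betw (mix T' g h) S B))"
      by (intro sum.cong) (auto simp: I_def)
    also have "\<dots> = card {(g, h) \<in> \<Omega>. bij_betw (mix T g h) S B \<and> bij_betw (mix T' g h) S B}"
      using \<Omega> by (simp add: sum.If_cases of_bool_def Int_def case_prod_unfold)
    also have "\<dots> = c (card (sym_diff T T'))"
      using that fin card card_bij_betw_mix_pair[of S B T T'] by (simp add: \<Omega>_def c_def)
    finally show ?thesis .
  qed
  have first: "(\<Sum>w\<in>\<Omega>. X w) = 2 ^ n * (fact n * real n ^ n)"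
  proof -
    \<comment> \<open>Indicators are idempotent, so the first moment is the diagonal case of
      \<open>pair\<close>, with empty difference.\<close>
    have "(\<Sum>w\<in>\<Omega>. X w) = (\<Sum>T\<in>Pow S. \<Sum>w\<in>\<Omega>. I T w * I T w)"
      unfolding X_def by (subst sum.swap) (simp add: I_def of_bool_conj[symmetric])
    also have "\<dots> = (\<Sum>T\<in>Pow S. c 0)"
      using pair by (intro sum.cong) auto
    finally show ?thesis using fin card by (simp add: c_def card_Pow)
  qed
  have "(\<Sum>w\<in>\<Omega>. (X w)\<^sup>2) = (\<Sum>T\<in>Pow S. \<Sum>T'\<in>Pow S. \<Sum>w\<in>\<Omega>. I T w * I T' w)"
    unfolding X_def power2_eq_square sum_product
    by (subst sum.swap, intro sum.cong refl, subst sum.swap) simp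
  also have "\<dots> = (\<Sum>T\<in>Pow S. \<Sum>T'\<in>Pow S. c (card (sym_diff T T')))"
    by (intro sum.cong refl pair)
  also have "\<dots> = (\<Sum>T\<in>Pow S. \<Sum>D\<in>Pow S. c (card D))"
    by (intro sum.cong[OF refl] sum_Pow_sym_diff[where c = "\<lambda>D. c (card D)"]) simp
  also have "\<dots> = 2 ^ n * (\<Sum>d\<le>n. real (n choose d) * c d)"
    using fin card by (simp add: sum_Pow_card card_Pow)
  \<comment> \<open>Since (n choose d) * d! = n! / (n - d)!, what remains are the terms of the
    exponential series at n, in reverse order.\<close>
  also have "(\<Sum>d\<le>n. real (n choose d) * c d) = (\<Sum>d\<le>n. (fact n)\<^sup>2 * (real n ^ (n - d) / fact (n - d)))"
    by (intro sum.cong refl) (simp add: c_def binomial_fact power2_eq_square)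
  also have "\<dots> = (fact n)\<^sup>2 * (\<Sum>m\<le>n. real n ^ m / fact m)"
    unfolding sum_distrib_left
    by (rule sum.reindex_bij_witness[of _ "\<lambda>m. n - m" "\<lambda>d. n - d"]) auto
  also have "2 ^ n * ((fact n)\<^sup>2 * (\<Sum>m\<le>n. real n ^ m / fact m)) \<le> 2 ^ n * ((fact n)\<^sup>2 * exp n)"
    by (intro mult_left_mono sum_power_div_fact_le_exp) auto
  finally have second: "(\<Sum>w\<in>\<Omega>. (X w)\<^sup>2) \<le> 2 ^ n * ((fact n)\<^sup>2 * exp n)" .
  have E: "{w \<in> \<Omega>. X w \<noteq> 0} = {(g, h) \<in> \<Omega>. \<exists>T\<subseteq>S. bij_betw (mix T g h) S B}"
    using fin by (auto simp: X_def I_def sum_nonneg_eq_0_iff)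
  let ?k = "real (card {w \<in> \<Omega>. X w \<noteq> 0})"
  have "(2 ^ n * (fact n * real n ^ n))\<^sup>2 \<le> ?k * (\<Sum>w\<in>\<Omega>. (X w)\<^sup>2)"
    using second_moment[OF \<Omega>, of X] by (simp add: first)
  also have "\<dots> \<le> ?k * (2 ^ n * ((fact n)\<^sup>2 * exp n))"
    using second by (rule mult_left_mono) simp
  \<comment> \<open>The common positive factor 2^n * (n!)^2 is set apart so that it can be
    cancelled.\<close>
  finally have "(2 ^ n * (fact n)\<^sup>2) * (2 ^ n * real n ^ (2 * n)) \<le> (2 ^ n * (fact n)\<^sup>2) * (exp n * ?k)"
    by (simp add: power_mult_distrib power2_eq_square mult_2_right power_add mult_ac)
  then have "2 ^ n * real n ^ (2 * n) \<le> exp n * ?k"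
    by (rule mult_left_le_imp_le) simp
  then show ?thesis unfolding E by (simp add: \<Omega>_def)
qed

section \<open>From counting to probability\<close>

lemma exists_choice_iff_exists_mix:
  "(\<exists>f \<in> S \<rightarrow> {0, 1::nat}. bij_betw (\<lambda>x. if f x = 0 then g x else h x) S B)
    \<longleftrightarrow> (\<exists>T\<subseteq>S. bij_betw (mix T g h) S B)" (is "?L \<longleftrightarrow> ?R")
proof
  assume ?L
  then obtain f :: "'a \<Rightarrow> nat" where f: "bij_betw (\<lambda>x. if f x = 0 then g x else h x) S B"
    by blast
  \<comment> \<open>The two functions are compared on \<open>S\<close> only; outside
    \<open>S\<close> they may differ.\<close>
  have "bij_betw (mix {x \<in> S. f x \<noteq> 0} g h) S B
      \<longleftrightarrow> bij_betw (\<lambda>x. if f x = 0 then g x else h x) S B"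
    by (rule bij_betw_cong) (simp add: mix_def)
  with f have "bij_betw (mix {x \<in> S. f x \<noteq> 0} g h) S B" by blast
  then show ?R by (intro exI[of _ "{x \<in> S. f x \<noteq> 0}"]) simp
next
  assume ?R
  then obtain T where T: "bij_betw (mix T g h) S B" by blast
  have "mix T g h = (\<lambda>x. if of_bool (x \<in> T) = (0::nat) then g x else h x)"
    by (simp add: mix_def fun_eq_iff)
  with T show ?L by (intro bexI[of _ "\<lambda>x. of_bool (x \<in> T)"]) simp_all
qed

text \<open>Each point of the product has mass 1 / (card A * card B) on both sides. This turns the
  probability into a quotient of cardinalities.\<close>

lemma pair_pmf_of_set:
  assumes "finite A" "A \<noteq> {}" "finite B" "B \<noteq> {}"
  shows "pair_pmf (pmf_of_set A) (pmf_of_set B) = pmf_of_set (A \<times> B)"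
proof (rule pmf_eqI)
  fix x :: "'a \<times> 'b"
  show "pmf (pair_pmf (pmf_of_set A) (pmf_of_set B)) x = pmf (pmf_of_set (A \<times> B)) x"
    using assms by (cases x) (simp add: pmf_pair card_cartesian_product indicator_def)
qed

theorem theorem5p5:
  fixes S :: "'k set" and n :: nat
  assumes "finite S" and "card S = n" and "n \<ge> 1"
  shows "measure_pmf.prob (pair_pmf (random_fun S n) (random_fun S n))
           {(h0, h1). \<exists>f \<in> S \<rightarrow> {0, 1::nat}.
              bij_betw (\<lambda>x. if f x = 0 then h0 x else h1 x) S {1..n}}
         \<ge> (exp 1 / 2) powi (- int n) * exp (-1) * sqrt pi"
proof -
  define A where "A = S \<rightarrow>\<^sub>E {1..n}"
  define E where "E = {(g, h) \<in> A \<times> A. \<exists>T\<subseteq>S. bij_betw (mix T g h) S {1..n}}"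
  have A: "finite A" "A \<noteq> {}" "card A = n ^ n"
    using assms by (auto simp: A_def card_funcsetE PiE_eq_empty_iff intro!: finite_PiE)
  have "measure_pmf.prob (pair_pmf (random_fun S n) (random_fun S n))
           {(h0, h1). \<exists>f \<in> S \<rightarrow> {0, 1::nat}.
              bij_betw (\<lambda>x. if f x = 0 then h0 x else h1 x) S {1..n}} = card E / card (A \<times> A)"
    using A unfolding random_fun_def A_def[symmetric] exists_choice_iff_exists_mix
    by (simp add: pair_pmf_of_set measure_pmf_of_set E_def Int_def case_prod_unfold mem_Times_iff)
  also have "card (A \<times> A) = n ^ (2 * n)"
    using A by (simp add: card_cartesian_product mult_2 power_add)
  finally have prob: "measure_pmf.prob (pair_pmf (random_fun S n) (random_fun S n))
           {(h0, h1). \<exists>f \<in> S \<rightarrow> {0, 1::nat}.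
              bij_betw (\<lambda>x. if f x = 0 then h0 x else h1 x) S {1..n}} = card E / n ^ (2 * n)"
    by simp
  \<comment> \<open>The chain sqrt pi \<le> 2 \<le> e uses pi < 4 and 1 + x \<le> exp x at x =
    1.\<close>
  have "sqrt pi \<le> sqrt 4"
    using pi_less_4 by (intro real_sqrt_le_mono) simp
  also have "\<dots> \<le> exp 1"
    using exp_ge_add_one_self[of 1] by simp
  finally have pi: "exp (-1) * sqrt pi \<le> 1"
    by (simp add: exp_minus field_simps)
  have pow: "(exp 1 / 2) powi (- int n) = 2 ^ n / exp (real n)"
    using exp_of_nat_mult[of n "1::real"] by (simp add: power_int_minus power_divide)
  have key: "2 ^ n * real n ^ (2 * n) \<le> exp (real n) * real (card E)"
    unfolding E_def A_def using assms by (intro card_exists_bij_mix_ge) auto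
  have "(exp 1 / 2) powi (- int n) * (exp (-1) * sqrt pi) \<le> 2 ^ n / exp (real n) * 1"
    unfolding pow using pi by (intro mult_left_mono) auto
  also have "\<dots> \<le> card E / n ^ (2 * n)"
    using key assms by (simp add: divide_simps mult.commute)
  finally show ?thesis unfolding prob by (simp add: mult.assoc)
qed

end
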